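(* Let $r_0,r_1,r_2:\mathbb N\to\mathbb N$ be strictly increasing functions whose ranges partition $\mathbb N$, with $r_0(1)=1$. Consider the staircase form with column support lengths $(r_1(n))$ and row support lengths $(r_2(n))$, i.e. the matrix form whose support entries are the positions $(i,j)$ with $i\le r_1(j)$ and $j\le r_2(i)$. (a) The staircase form has density $1/2$ when $r_0,r_1,r_2$ are the strictly increasing functions with ranges $$r_0(\mathbb N)=\{1\}\cup\{3^k: k>1\},$$ $$r_1(\mathbb N)=\{2\}\cup\{3^k+j: k\ge1,\ 1\le j\le2\cdot3^{k-1}\},$$ $$r_2(\mathbb N)=\{3\}\cup\{3^k+j: k\ge1,\ 2\cdot3^{k-1}<j<2\cdot3^k\}.$$ (b) More generally, the staircase form has density $1/2$ whenever $\lim_{n\to\infty}n/r_0(n)=0$.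
   Context: $\mathbb N=\{1,2,\dots\}$. A matrix form is specified by a set of positions $(i,j)\in\mathbb N\times\mathbb N$ at which matrices of the form must be zero; the positions in the complement are its support entries. For $N\in\mathbb N$, $L_N$ denotes the number of support entries $(i,j)$ with $1\le i,j\le N$. The density of the form is $\lim_{N\to\infty}L_N/N^2$, whenever this limit exists. *)

theory Defs
  imports Complex_Main "HOL-Library.Infinite_Set"
begin

text \<open>
  The set \<open>{1, 2, \<dots>}\<close> is \<open>{1..} :: nat set\<close>; a function on it is a function on \<open>nat\<close> whose
  value at \<open>0\<close> is irrelevant. A matrix form is given by its set of prescribed zero positions.
\<close>

type_synonym matrix_form = "(nat \<times> nat) set"

definition support_entries :: "matrix_form \<Rightarrow> (nat \<times> nat) set" where
  "support_entries Z = ({1..} \<times> {1..}) - Z"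

definition support_count :: "matrix_form \<Rightarrow> nat \<Rightarrow> nat" where
  "support_count Z N = card {(i, j) \<in> support_entries Z. i \<le> N \<and> j \<le> N}"

text \<open>The limit defining the density exists and equals \<open>d\<close>.\<close>

definition has_density :: "matrix_form \<Rightarrow> real \<Rightarrow> bool" where
  "has_density Z d \<longleftrightarrow> (\<lambda>N. real (support_count Z N) / (real N)\<^sup>2) \<longlonglongrightarrow> d"

definition staircase_form :: "(nat \<Rightarrow> nat) \<Rightarrow> (nat \<Rightarrow> nat) \<Rightarrow> matrix_form" where
  "staircase_form c r = {(i, j) \<in> {1..} \<times> {1..}. \<not> (i \<le> c j \<and> j \<le> r i)}"

lemma support_entries_staircase_form:
  "support_entries (staircase_form c r) = {(i, j). 1 \<le> i \<and> 1 \<le> j \<and> i \<le> c j \<and> j \<le> r i}"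
  by (auto simp: support_entries_def staircase_form_def)

definition partitioning_triple :: "(nat \<Rightarrow> nat) \<Rightarrow> (nat \<Rightarrow> nat) \<Rightarrow> (nat \<Rightarrow> nat) \<Rightarrow> bool" where
  "partitioning_triple r0 r1 r2 \<longleftrightarrow>
     strict_mono_on {1..} r0 \<and> strict_mono_on {1..} r1 \<and> strict_mono_on {1..} r2 \<and>
     r0 ` {1..} \<inter> r1 ` {1..} = {} \<and> r0 ` {1..} \<inter> r2 ` {1..} = {} \<and> r1 ` {1..} \<inter> r2 ` {1..} = {} \<and>
     r0 ` {1..} \<union> r1 ` {1..} \<union> r2 ` {1..} = {1..}"

text \<open>The three ranges of the power-of-three example.\<close>

definition pow3_range0 :: "nat set" where
  "pow3_range0 = {1} \<union> {3 ^ k | k. k > 1}"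

definition pow3_range1 :: "nat set" where
  "pow3_range1 = {2} \<union> {3 ^ k + j | k j. k \<ge> 1 \<and> 1 \<le> j \<and> j \<le> 2 * 3 ^ (k - 1)}"

definition pow3_range2 :: "nat set" where
  "pow3_range2 = {3} \<union> {3 ^ k + j | k j. k \<ge> 1 \<and> 2 * 3 ^ (k - 1) < j \<and> j < 2 * 3 ^ k}"

text \<open>The example is an instance of the general setting: such functions exist.\<close>

lemma pow3_unique:
  fixes n k l :: nat
  assumes "3 ^ k \<le> n" "n < 3 * 3 ^ k" "3 ^ l \<le> n" "n < 3 * 3 ^ l"
  shows "k = l"
proof -
  have "(3::nat) ^ k < 3 ^ Suc l" "(3::nat) ^ l < 3 ^ Suc k"
    unfolding power_Suc using assms by linarith+
  then have "k < Suc l" "l < Suc k"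
    by (auto simp del: power_Suc)
  then show ?thesis by simp
qed

lemma pow3_ranges_disjoint:
  "pow3_range0 \<inter> pow3_range1 = {}" "pow3_range0 \<inter> pow3_range2 = {}"
  "pow3_range1 \<inter> pow3_range2 = {}"
proof -
  have ge: "(3::nat) ^ k \<ge> 3" if "k \<ge> 1" for k
    using power_increasing[OF that, of "3::nat"] by simp
  have s: "(3::nat) ^ (k - 1) < 3 ^ k" if "k \<ge> 1" for k
    by (intro power_strict_increasing) (use that in auto)
  show "pow3_range0 \<inter> pow3_range1 = {}"
  proof (rule ccontr)
    assume "\<not> ?thesis"
    then obtain x where x: "x \<in> pow3_range0" "x \<in> pow3_range1" by blast
    then have "x = 1 \<or> x \<ge> 3" using ge by (auto simp: pow3_range0_def)
    with x(2) obtain k j where k: "k \<ge> 1" "x = 3 ^ k + j" "1 \<le> j" "j \<le> 2 * 3 ^ (k - 1)"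
      by (auto simp: pow3_range1_def)
    then have "x > 3" using ge[of k] by linarith
    then obtain l where l: "x = 3 ^ l" using x(1) by (auto simp: pow3_range0_def)
    have "l = k" by (rule pow3_unique[of _ x]) (use k s[of k, OF k(1)] l \<open>x > 3\<close> in \<open>linarith+\<close>)
    then show False using k l by simp
  qed
  show "pow3_range0 \<inter> pow3_range2 = {}"
  proof (rule ccontr)
    assume "\<not> ?thesis"
    then obtain x where x: "x \<in> pow3_range0" "x \<in> pow3_range2" by blast
    have "(3::nat) ^ k \<noteq> 3" if "k > 1" for k
      using power_strict_increasing[OF that, of "3::nat"] by simp
    then have "x \<noteq> 3" using x(1) by (auto simp: pow3_range0_def)
    with x(2) obtain k j where k: "k \<ge> 1" "x = 3 ^ k + j" "2 * 3 ^ (k - 1) < j" "j < 2 * 3 ^ k"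
      by (auto simp: pow3_range2_def)
    then have "x > 3" using ge[of k] by linarith
    then obtain l where l: "x = 3 ^ l" using x(1) by (auto simp: pow3_range0_def)
    have "l = k" by (rule pow3_unique[of _ x]) (use k l \<open>x > 3\<close> in \<open>linarith+\<close>)
    then show False using k l by simp
  qed
  show "pow3_range1 \<inter> pow3_range2 = {}"
  proof (rule ccontr)
    assume "\<not> ?thesis"
    then obtain x where x: "x \<in> pow3_range1" "x \<in> pow3_range2" by blast
    have "x \<noteq> 2"
    proof
      assume "x = 2"
      then obtain k j :: nat where "k \<ge> 1" "2 = 3 ^ k + j"
        using x(2) by (auto simp: pow3_range2_def)
      then show False using ge[of k] by linarith
    qed
    with x(1) obtain k j where k: "k \<ge> 1" "x = 3 ^ k + j" "1 \<le> j" "j \<le> 2 * 3 ^ (k - 1)"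
      by (auto simp: pow3_range1_def)
    then have "x > 3" using ge[of k] by linarith
    then obtain l i where l: "l \<ge> 1" "x = 3 ^ l + i" "2 * 3 ^ (l - 1) < i" "i < 2 * 3 ^ l"
      using x(2) by (auto simp: pow3_range2_def)
    have "l = k" by (rule pow3_unique[of _ x]) (use k s[of k, OF k(1)] l \<open>x > 3\<close> in \<open>linarith+\<close>)
    then show False using k l by simp
  qed
qed

lemma pow3_ranges_cover: "pow3_range0 \<union> pow3_range1 \<union> pow3_range2 = {1..}"
proof
  show "pow3_range0 \<union> pow3_range1 \<union> pow3_range2 \<subseteq> {1..}"
    by (auto simp: pow3_range0_def pow3_range1_def pow3_range2_def Suc_le_eq)
  show "{1..} \<subseteq> pow3_range0 \<union> pow3_range1 \<union> pow3_range2"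
  proof
    fix n :: nat assume "n \<in> {1..}"
    then consider "n = 1" | "n = 2" | "n = 3" | "n > 3" by force
    then show "n \<in> pow3_range0 \<union> pow3_range1 \<union> pow3_range2"
    proof cases
      case 4
      then obtain k where k: "3 ^ k \<le> n" "n < 3 ^ (k + 1)"
        using ex_power_ivl1[of 3 n] by auto
      have "k \<noteq> 0" using k 4 by (intro notI) simp
      define j where "j = n - 3 ^ k"
      have j: "n = 3 ^ k + j" "j < 2 * 3 ^ k" using k by (auto simp: j_def)
      consider "j = 0" | "1 \<le> j" "j \<le> 2 * 3 ^ (k - 1)" | "2 * 3 ^ (k - 1) < j" by linarith
      then show ?thesis
      proof cases
        case 1
        have "k \<noteq> 1" using 1 j 4 by auto
        then show ?thesis using 1 j \<open>k \<noteq> 0\<close> by (auto simp: pow3_range0_def)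
      next
        case 2
        then have "n \<in> pow3_range1" using j \<open>k \<noteq> 0\<close> unfolding pow3_range1_def by fastforce
        then show ?thesis by blast
      next
        case 3
        then have "n \<in> pow3_range2" using j \<open>k \<noteq> 0\<close> unfolding pow3_range2_def by fastforce
        then show ?thesis by blast
      qed
    qed (auto simp: pow3_range0_def pow3_range1_def pow3_range2_def)
  qed
qed

lemma infinite_pow3_ranges: "infinite pow3_range0" "infinite pow3_range1" "infinite pow3_range2"
proof -
  have big: "m < (3::nat) ^ m" for m :: nat
    by (induction m) auto
  have "\<exists>x\<in>pow3_range0. m < x" "\<exists>x\<in>pow3_range1. m < x" "\<exists>x\<in>pow3_range2. m < x" for m
  proof -
    have b: "m < 3 ^ (m + 2)" using big[of "m + 2"] by linarith
    have "3 ^ (m + 2) \<in> pow3_range0" by (force simp: pow3_range0_def)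
    then show "\<exists>x\<in>pow3_range0. m < x" using b by blast
    have "3 ^ (m + 2) + 1 \<in> pow3_range1"
      unfolding pow3_range1_def
      by (intro UnI2 CollectI exI[of _ "m + 2"] exI[of _ 1]) (simp add: Suc_le_eq)
    then show "\<exists>x\<in>pow3_range1. m < x" using b by (meson trans_less_add1)
    have "3 ^ (m + 2) + 3 ^ (m + 2) \<in> pow3_range2"
      unfolding pow3_range2_def
      by (intro UnI2 CollectI exI[of _ "m + 2"] exI[of _ "3 ^ (m + 2)"]) simp
    then show "\<exists>x\<in>pow3_range2. m < x" using b by (meson trans_less_add1)
  qed
  then show "infinite pow3_range0" "infinite pow3_range1" "infinite pow3_range2"
    unfolding infinite_nat_iff_unbounded by blast+
qed

lemma ex_strict_mono_on_range:
  fixes S :: "nat set"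
  assumes "infinite S"
  shows "\<exists>r :: nat \<Rightarrow> nat. strict_mono_on {1..} r \<and> r ` {1..} = S"
proof -
  let ?r = "\<lambda>n::nat. enumerate S (n - 1)"
  have mono: "strict_mono_on {1..} ?r"
    by (rule strict_mono_onI) (auto intro!: enumerate_mono assms)
  have "(\<lambda>n::nat. n - 1) ` {1..} = UNIV"
  proof (rule set_eqI)
    fix m :: nat
    show "m \<in> (\<lambda>n::nat. n - 1) ` {1..} \<longleftrightarrow> m \<in> UNIV"
      using image_eqI[of m "\<lambda>n::nat. n - 1" "Suc m" "{1..}"] by simp
  qed
  then have "?r ` {1..} = range (enumerate S)"
    by (metis image_image)
  then have "?r ` {1..} = S"
    by (simp add: range_enumerate assms)
  with mono show ?thesis by blast
qed

lemma pow3_partitioning_triple: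
  "\<exists>r0 r1 r2. partitioning_triple r0 r1 r2 \<and> r0 1 = 1 \<and>
     r0 ` {1..} = pow3_range0 \<and> r1 ` {1..} = pow3_range1 \<and> r2 ` {1..} = pow3_range2"
proof -
  obtain r0 r1 r2 :: "nat \<Rightarrow> nat" where r:
    "strict_mono_on {1..} r0" "r0 ` {1..} = pow3_range0"
    "strict_mono_on {1..} r1" "r1 ` {1..} = pow3_range1"
    "strict_mono_on {1..} r2" "r2 ` {1..} = pow3_range2"
    using ex_strict_mono_on_range[OF infinite_pow3_ranges(1)]
      ex_strict_mono_on_range[OF infinite_pow3_ranges(2)]
      ex_strict_mono_on_range[OF infinite_pow3_ranges(3)] by blast
  have "1 \<in> r0 ` {1..}" unfolding r(2) by (simp add: pow3_range0_def)
  then obtain n where n: "n \<ge> 1" "r0 n = 1" by auto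
  have "r0 1 \<in> pow3_range0" using r(2) by blast
  then have "r0 1 \<ge> 1" using pow3_ranges_cover by auto
  moreover have "r0 1 \<le> r0 n" using n strict_mono_on_leD[OF r(1), of 1 n] by simp
  ultimately have "r0 1 = 1" using n by simp
  then show ?thesis
    unfolding partitioning_triple_def
    by (intro exI[of _ r0] exI[of _ r1] exI[of _ r2])
      (simp add: r[unfolded One_nat_def] pow3_ranges_disjoint pow3_ranges_cover)
qed

end

theory Submission
  imports Defs
begin

text \<open>
  Both parts rest on an exact formula for \<open>L\<^sub>N\<close>. In the square \<open>[1,N]\<^sup>2\<close> a position is zero
  because it lies below the end of its column (\<open>r\<^sub>1(j) < i\<close>) or to the right of the end of its row
  (\<open>r\<^sub>2(i) < j\<close>). Since \<open>n \<le> r\<^sub>k(n)\<close>, the first kind lies strictly below the diagonal and the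
  second strictly above it, so no position is counted twice
  (\<open>support_count_staircase_form\<close>). A column whose support ends at height \<open>m = r\<^sub>1(j) \<le> N\<close>
  contributes \<open>N - m\<close> zeros, and likewise for rows, so the number of zeros is the sum of \<open>N - m\<close>
  over all \<open>m \<le> N\<close> in the ranges of \<open>r\<^sub>1\<close> and \<open>r\<^sub>2\<close>. As the three ranges partition \<open>\<nat>\<close>, this is
  \<open>N(N - 1)/2\<close> minus the same sum over the range of \<open>r\<^sub>0\<close>. Hence
  (\<open>support_count_partitioning_triple\<close>)
  \<open>L\<^sub>N = N(N + 1)/2 + E\<^sub>N\<close>, where \<open>E\<^sub>N\<close> is the sum of \<open>N - m\<close> over the \<open>m \<le> N\<close> in the range of \<open>r\<^sub>0\<close>.

  The error \<open>E\<^sub>N\<close> is at most \<open>N\<close> times the number of \<open>n\<close> with \<open>r\<^sub>0(n) \<le> N\<close>. If \<open>n/r\<^sub>0(n)\<close> tends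
  to \<open>0\<close>, that number is \<open>o(N)\<close> (\<open>counting_function_sublinear\<close>), so the density is \<open>1/2\<close>.
  This is (b). In (a), each value of \<open>r\<^sub>0\<close> is at least three times the previous one, so \<open>r\<^sub>0\<close> grows
  exponentially and (b) applies.
\<close>

section \<open>Counting the zeros of a staircase\<close>

lemma strict_mono_on_ge_self:
  fixes f :: "nat \<Rightarrow> nat"
  assumes "strict_mono_on {1..} f" "f ` {1..} \<subseteq> {1..}" "1 \<le> n"
  shows "n \<le> f n"
  using assms(3)
proof (induction n rule: dec_induct)
  case base
  show ?case using assms(2) by auto
next
  case (step n)
  have "f n < f (Suc n)"
    using strict_mono_onD[OF assms(1), of n "Suc n"] step by simp
  with step show ?case by simp
qed

text \<open>
  The sum of \<open>N - m\<close> over the \<open>m \<le> N\<close> in the range of \<open>f\<close> appears because the column indexed by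
  \<open>j\<close> has \<open>N - f j\<close> entries below its end. Every column with \<open>f j \<le> N\<close> lies inside the square,
  as \<open>j \<le> f j\<close>. Rows are covered by transposing.
\<close>
lemma card_beyond_ends:
  fixes f :: "nat \<Rightarrow> nat"
  assumes "strict_mono_on {1..} f" "f ` {1..} \<subseteq> {1..}"
  shows "card {(i, j). 1 \<le> j \<and> i \<le> N \<and> j \<le> N \<and> f j < i} = (\<Sum>m\<in>f ` {1..} \<inter> {1..N}. N - m)"
proof -
  define J where "J = {j. 1 \<le> j \<and> f j \<le> N}"
  have J_le: "j \<le> N" if "j \<in> J" for j
    using that strict_mono_on_ge_self[OF assms, of j] by (simp add: J_def)
  then have "finite J" by (meson finite_nat_set_iff_bounded_le)
  have "{(i, j). 1 \<le> j \<and> i \<le> N \<and> j \<le> N \<and> f j < i}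
      = prod.swap ` (SIGMA j:J. {f j<..N})"
    using J_le by (force simp: J_def image_iff)
  then have "card {(i, j). 1 \<le> j \<and> i \<le> N \<and> j \<le> N \<and> f j < i}
      = card (SIGMA j:J. {f j<..N})"
    by (simp add: card_image)
  also have "\<dots> = (\<Sum>j\<in>J. N - f j)"
    using \<open>finite J\<close> by simp
  also have "\<dots> = (\<Sum>m\<in>f ` J. N - m)"
  proof -
    have "inj_on f J"
      by (rule inj_on_subset[OF strict_mono_on_imp_inj_on[OF assms(1)]]) (auto simp: J_def)
    then show ?thesis by (simp add: sum.reindex)
  qed
  also have "f ` J = f ` {1..} \<inter> {1..N}"
    using assms(2) by (auto simp: J_def)
  finally show ?thesis .
qed

text \<open>
  The square splits into support entries, positions below a column end and positions right of a
  row end. The last two are disjoint because \<open>j \<le> c j < i\<close> for one and \<open>i \<le> r i < j\<close> for the other.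
\<close>
lemma support_count_staircase_form:
  assumes c: "strict_mono_on {1..} c" "c ` {1..} \<subseteq> {1..}"
    and r: "strict_mono_on {1..} r" "r ` {1..} \<subseteq> {1..}"
  shows "support_count (staircase_form c r) N
    + ((\<Sum>m\<in>c ` {1..} \<inter> {1..N}. N - m) + (\<Sum>m\<in>r ` {1..} \<inter> {1..N}. N - m)) = N\<^sup>2"
proof -
  define S where "S = {(i, j) \<in> support_entries (staircase_form c r). i \<le> N \<and> j \<le> N}"
  define C where "C = {(i, j). 1 \<le> j \<and> i \<le> N \<and> j \<le> N \<and> c j < i}"
  define R' where "R' = {(i, j). 1 \<le> j \<and> i \<le> N \<and> j \<le> N \<and> r j < i}"
  define R where "R = prod.swap ` R'"
  have R: "R = {(i, j). 1 \<le> i \<and> i \<le> N \<and> j \<le> N \<and> r i < j}"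
    by (force simp: R_def R'_def image_iff)
  note ge = strict_mono_on_ge_self[OF c] strict_mono_on_ge_self[OF r]
  have fin: "finite S" "finite C" "finite R"
    by (rule finite_subset[of _ "{..N} \<times> {..N}"]; auto simp: S_def C_def R)+
  have "card S + (card C + card R) = card (S \<union> (C \<union> R))"
  proof -
    have "\<not> (c j < i \<and> r i < j)" if "1 \<le> i" "1 \<le> j" for i j
      using ge(1)[OF that(2)] ge(2)[OF that(1)] by linarith
    then have "C \<inter> R = {}"
      by (auto simp: C_def R)
    moreover have "S \<inter> (C \<union> R) = {}"
      by (auto simp: S_def C_def R support_entries_staircase_form)
    ultimately show ?thesis
      using fin by (simp add: card_Un_disjoint)
  qed
  also have "S \<union> (C \<union> R) = {1..N} \<times> {1..N}"
    using ge
    by (fastforce simp: S_def C_def R support_entries_staircase_form)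
  finally have "card S + (card C + card R') = N\<^sup>2"
    by (simp add: R_def card_image power2_eq_square)
  then show ?thesis
    using card_beyond_ends[OF c, of N] card_beyond_ends[OF r, of N]
    by (simp add: S_def C_def R'_def support_count_def)
qed

text \<open>
  The sum of \<open>N - m\<close> over all \<open>m \<le> N\<close> is \<open>N(N - 1)/2\<close>, and the three ranges share it out. Taking
  away the shares of \<open>r1\<close> and \<open>r2\<close> from \<open>N\<^sup>2\<close> leaves \<open>N(N + 1)/2\<close> plus the share of \<open>r0\<close>; both
  sides are doubled to stay in \<open>\<nat>\<close>.
\<close>
lemma support_count_partitioning_triple:
  assumes "partitioning_triple r0 r1 r2"
  shows "2 * support_count (staircase_form r1 r2) N
    = N * (N + 1) + 2 * (\<Sum>m\<in>r0 ` {1..} \<inter> {1..N}. N - m)"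
proof -
  let ?s = "\<lambda>f::nat \<Rightarrow> nat. \<Sum>m\<in>f ` {1..} \<inter> {1..N}. N - m"
  have mono: "strict_mono_on {1..} r1" "strict_mono_on {1..} r2"
    and disj: "r0 ` {1..} \<inter> r1 ` {1..} = {}" "r0 ` {1..} \<inter> r2 ` {1..} = {}"
      "r1 ` {1..} \<inter> r2 ` {1..} = {}"
    and cover: "r0 ` {1..} \<union> r1 ` {1..} \<union> r2 ` {1..} = {1..}"
    using assms unfolding partitioning_triple_def by blast+
  have count: "support_count (staircase_form r1 r2) N + (?s r1 + ?s r2) = N\<^sup>2"
    using cover by (intro support_count_staircase_form mono) blast+
  have "?s r0 + (?s r1 + ?s r2)
      = (\<Sum>m\<in>(r0 ` {1..} \<inter> {1..N}) \<union> ((r1 ` {1..} \<inter> {1..N}) \<union> (r2 ` {1..} \<inter> {1..N})). N - m)"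
  proof -
    have "(r0 ` {1..} \<inter> {1..N}) \<inter> ((r1 ` {1..} \<inter> {1..N}) \<union> (r2 ` {1..} \<inter> {1..N})) = {}"
      "(r1 ` {1..} \<inter> {1..N}) \<inter> (r2 ` {1..} \<inter> {1..N}) = {}"
      using disj by blast+
    then show ?thesis
      by (simp only: sum.union_disjoint finite_Un finite_Int finite_atLeastAtMost simp_thms)
  qed
  also have "(r0 ` {1..} \<inter> {1..N}) \<union> ((r1 ` {1..} \<inter> {1..N}) \<union> (r2 ` {1..} \<inter> {1..N})) = {1..N}"
    using cover by auto
  finally have parts: "?s r0 + (?s r1 + ?s r2) = (\<Sum>m\<in>{1..N}. N - m)" .
  have total: "2 * (\<Sum>m\<in>{1..N}. N - m) + N = N\<^sup>2" for N :: nat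
  proof -
    have "(\<Sum>m\<in>{1..N}. N - m) = \<Sum>{..<N}"
      by (rule sum.reindex_bij_witness[of _ "\<lambda>k. N - k" "\<lambda>m. N - m"]) auto
    moreover have "2 * \<Sum>{..<N} + N = N\<^sup>2"
      by (induction N) (auto simp: power2_eq_square)
    ultimately show ?thesis by simp
  qed
  show ?thesis
    using count parts total[of N] by (simp add: power2_eq_square algebra_simps)
qed

section \<open>Sparse ranges\<close>

text \<open>
  If \<open>n \<le> \<epsilon> f(n)\<close> from some \<open>M\<close> on, then every \<open>n\<close> with \<open>f(n) \<le> N\<close> satisfies \<open>n < M\<close> or
  \<open>n \<le> \<epsilon> N\<close>, which leaves at most \<open>M + \<epsilon> N\<close> of them.
\<close>
lemma counting_function_sublinear:
  fixes f :: "nat \<Rightarrow> nat"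
  assumes pos: "f ` {1..} \<subseteq> {1..}"
    and lim: "(\<lambda>n. real n / real (f n)) \<longlonglongrightarrow> 0"
  shows "(\<lambda>N. real (card (f ` {1..} \<inter> {1..N})) / real N) \<longlonglongrightarrow> 0"
proof (rule LIMSEQ_I)
  fix e :: real assume "0 < e"
  then have "eventually (\<lambda>n. real n / real (f n) < e / 2) sequentially"
    using order_tendstoD(2)[OF lim, of "e / 2"] by simp
  then obtain M where M: "real n / real (f n) < e / 2" if "n \<ge> M" for n
    unfolding eventually_sequentially by blast
  have count: "real (card (f ` {1..} \<inter> {1..N})) \<le> real M + e / 2 * real N" for N
  proof -
    let ?K = "M + nat \<lfloor>e / 2 * real N\<rfloor>"
    have "f ` {1..} \<inter> {1..N} \<subseteq> f ` {1..?K}"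
    proof
      fix m assume "m \<in> f ` {1..} \<inter> {1..N}"
      then obtain n where n: "n \<ge> 1" "m = f n" "f n \<le> N" by auto
      have "n \<le> ?K"
      proof (cases "n \<ge> M")
        case True
        have "f n \<in> {1..}" using pos n(1) by blast
        then have "0 < f n" by simp
        then have "real n \<le> e / 2 * real (f n)"
          using M[OF True] by (simp add: divide_less_eq)
        also have "\<dots> \<le> e / 2 * real N"
          using n(3) \<open>0 < e\<close> by (intro mult_left_mono) auto
        finally have "n \<le> nat \<lfloor>e / 2 * real N\<rfloor>"
          by (simp add: le_nat_floor)
        then show ?thesis by simp
      qed simp
      then show "m \<in> f ` {1..?K}" using n by auto
    qed
    then have "card (f ` {1..} \<inter> {1..N}) \<le> card (f ` {1..?K})"
      by (intro card_mono) auto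
    also have "\<dots> \<le> ?K"
      using card_image_le[of "{1..?K}" f] by simp
    finally have "real (card (f ` {1..} \<inter> {1..N})) \<le> real ?K"
      by (simp only: of_nat_le_iff)
    also have "\<dots> \<le> real M + e / 2 * real N"
      using \<open>0 < e\<close> of_nat_floor[of "e / 2 * real N"] by simp
    finally show ?thesis .
  qed
  obtain K :: nat where K: "2 * real M / e < real K"
    using reals_Archimedean2 by blast
  show "\<exists>no. \<forall>N\<ge>no. norm (real (card (f ` {1..} \<inter> {1..N})) / real N - 0) < e"
  proof (intro exI[of _ "Suc K"] allI impI)
    fix N assume N: "N \<ge> Suc K"
    have "2 * real M / e < real N" using K N by simp
    then have "real M < e / 2 * real N"
      using \<open>0 < e\<close> by (simp add: field_simps)
    then have "real (card (f ` {1..} \<inter> {1..N})) < e * real N"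
      using count[of N] by linarith
    then show "norm (real (card (f ` {1..} \<inter> {1..N})) / real N - 0) < e"
      using N by (simp add: divide_less_eq)
  qed
qed

lemma has_density_half_of_sparse:
  assumes part: "partitioning_triple r0 r1 r2"
    and lim: "(\<lambda>n. real n / real (r0 n)) \<longlonglongrightarrow> 0"
  shows "has_density (staircase_form r1 r2) (1 / 2)"
proof -
  define E where "E N = (\<Sum>m\<in>r0 ` {1..} \<inter> {1..N}. N - m)" for N
  define k where "k N = card (r0 ` {1..} \<inter> {1..N})" for N
  have "r0 ` {1..} \<subseteq> {1..}"
    using part unfolding partitioning_triple_def by blast
  then have k: "(\<lambda>N. real (k N) / real N) \<longlonglongrightarrow> 0"
    unfolding k_def using lim by (rule counting_function_sublinear)
  have E_le: "E N \<le> k N * N" for N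
    unfolding E_def k_def by (rule sum_bounded_above[of _ _ N, simplified]) simp
  have "(\<lambda>N. real (E N) / (real N)\<^sup>2) \<longlonglongrightarrow> 0"
  proof (rule tendsto_sandwich[OF _ _ tendsto_const k])
    show "\<forall>\<^sub>F N in sequentially. real (E N) / (real N)\<^sup>2 \<le> real (k N) / real N"
      using eventually_gt_at_top[of 0]
    proof eventually_elim
      case (elim N)
      have "real (E N) \<le> real (k N) * real N"
        using E_le[of N] by (metis of_nat_le_iff of_nat_mult)
      then show ?case using elim by (simp add: divide_simps power2_eq_square)
    qed
  qed simp
  moreover have "(\<lambda>N. 1 / real N) \<longlonglongrightarrow> 0"
    by (rule lim_1_over_n)
  ultimately have "(\<lambda>N. 1 / 2 + 1 / 2 * (1 / real N) + real (E N) / (real N)\<^sup>2)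
      \<longlonglongrightarrow> 1 / 2 + 1 / 2 * 0 + 0"
    by (intro tendsto_intros)
  moreover have "\<forall>\<^sub>F N in sequentially. 1 / 2 + 1 / 2 * (1 / real N) + real (E N) / (real N)\<^sup>2
      = real (support_count (staircase_form r1 r2) N) / (real N)\<^sup>2"
    using eventually_gt_at_top[of 0]
  proof eventually_elim
    case (elim N)
    have "real (2 * support_count (staircase_form r1 r2) N) = real (N * (N + 1) + 2 * E N)"
      unfolding E_def using support_count_partitioning_triple[OF part, of N] by (simp only:)
    then have "real (support_count (staircase_form r1 r2) N)
        = (real N)\<^sup>2 / 2 + real N / 2 + real (E N)"
      by (simp add: power2_eq_square algebra_simps)
    then show ?case using elim by (simp add: field_simps power2_eq_square)
  qed
  ultimately show ?thesis
    unfolding has_density_def by (simp add: tendsto_cong)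
qed

section \<open>The power-of-three example\<close>

text \<open>
  Distinct powers of three differ by a factor of at least \<open>3\<close>, and this forces exponential growth
  of any increasing enumeration.
\<close>
lemma pow3_range0_gap:
  assumes "x \<in> pow3_range0" "y \<in> pow3_range0" "x < y"
  shows "3 * x \<le> y"
proof -
  have pow: "\<exists>k. z = 3 ^ k" if "z \<in> pow3_range0" for z
    using that unfolding pow3_range0_def by (auto intro: exI[of _ 0])
  obtain k l where "x = 3 ^ k" "y = 3 ^ l"
    using pow assms by blast
  moreover from this have "Suc k \<le> l"
    using assms(3) by simp
  ultimately show ?thesis
    using power_increasing[of "Suc k" l "3::nat"] by simp
qed

lemma pow3_range0_sparse:
  assumes mono: "strict_mono_on {1..} r" and range: "r ` {1..} = pow3_range0"
  shows "(\<lambda>n. real n / real (r n)) \<longlonglongrightarrow> 0"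
proof -
  have in_range: "r n \<in> pow3_range0" if "1 \<le> n" for n
    using that range by blast
  have growth: "3 ^ n \<le> 3 * r n" if "1 \<le> n" for n
    using that
  proof (induction n rule: dec_induct)
    case base
    have "r 1 \<noteq> 0"
      using in_range[of 1] by (auto simp: pow3_range0_def)
    then show ?case by simp
  next
    case (step n)
    have "r n < r (Suc n)"
      using strict_mono_onD[OF mono, of n "Suc n"] step by simp
    then have "3 * r n \<le> r (Suc n)"
      using in_range[of n] in_range[of "Suc n"] step by (intro pow3_range0_gap) auto
    with step show ?case by simp
  qed
  have "(\<lambda>n. 3 * (real n / 3 ^ n)) \<longlonglongrightarrow> 3 * 0"
    using powser_times_n_limit_0[of "1 / 3 :: real"]
    by (intro tendsto_intros) (simp add: power_divide)
  then have upper: "(\<lambda>n. 3 * (real n / 3 ^ n)) \<longlonglongrightarrow> 0"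
    by simp
  show ?thesis
  proof (rule tendsto_sandwich[OF _ _ tendsto_const upper])
    show "\<forall>\<^sub>F n in sequentially. real n / real (r n) \<le> 3 * (real n / 3 ^ n)"
      using eventually_ge_at_top[of 1]
    proof eventually_elim
      case (elim n)
      have "real (3 ^ n) \<le> real (3 * r n)"
        using growth[OF elim] by (simp only: of_nat_le_iff)
      then have g: "3 ^ n \<le> 3 * real (r n)" by simp
      have "real n / real (r n) = 3 * real n / (3 * real (r n))" by simp
      also have "\<dots> \<le> 3 * real n / 3 ^ n"
        by (rule frac_le[OF _ order_refl _ g]) auto
      finally show ?case by simp
    qed
  qed simp
qed

theorem theorem5p3:
  fixes r0 r1 r2 :: "nat \<Rightarrow> nat"
  assumes "partitioning_triple r0 r1 r2"
    and "r0 1 = 1"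
  shows "(r0 ` {1..} = pow3_range0 \<and> r1 ` {1..} = pow3_range1 \<and> r2 ` {1..} = pow3_range2
            \<longrightarrow> has_density (staircase_form r1 r2) (1 / 2)) \<and>
         ((\<lambda>n. real n / real (r0 n)) \<longlonglongrightarrow> 0
            \<longrightarrow> has_density (staircase_form r1 r2) (1 / 2))"
proof (intro conjI impI; (elim conjE)?)
  assume "r0 ` {1..} = pow3_range0"
  moreover have "strict_mono_on {1..} r0"
    using assms(1) unfolding partitioning_triple_def by blast
  ultimately show "has_density (staircase_form r1 r2) (1 / 2)"
    by (intro has_density_half_of_sparse[OF assms(1)] pow3_range0_sparse)
next
  assume "(\<lambda>n. real n / real (r0 n)) \<longlonglongrightarrow> 0"
  then show "has_density (staircase_form r1 r2) (1 / 2)"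
    by (rule has_density_half_of_sparse[OF assms(1)])
qed

end
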